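(* Let $F\subset\mathbb{R}^d$ be a self-similar set, not contained in any $(d-1)$-dimensional hyperplane, that is the attractor of an IFS $\mathcal S$ that does not satisfy the weak separation property. Let $\omega^1,\dots,\omega^s$ be $s$ linearly independent overlapping directions for $\mathcal S$ (so $s\le\dim V_{\mathcal S}$), and let $W=\{t_1\omega^1+\dots+t_s\omega^s:0\le t_i\le1\}$ be the $s$-parallelotope having the origin as a vertex and whose edges radiating from the origin, all of unit length, are parallel to $\omega^1,\dots,\omega^s$. Then there is a weak tangent of $F$ containing the set $W+F=\{w+x:w\in W,x\in F\}$.
   Context: IFS and attractor: an IFS is a finite family $\mathcal S=\{S_1,\dots,S_m\}$ of contractive similitudes of $\mathbb{R}^d$, $S_i(x)=c_iO_ix+b_i$ with $c_i\in(0,1)$, $O_i$ a $d\times d$ orthogonal matrix, $b_i\in\mathbb{R}^d$. Its attractor is the unique nonempty compact $F$ with $F=\bigcup_{i=1}^m S_i(F)$; such an $F$ is called a self-similar set. $\mathcal I=\{1,\dots,m\}$, $\mathcal I^\ast=\bigcup_{k\ge1}\mathcal I^k$, and for $\alpha=(i_1,\dots,i_k)\in\mathcal I^\ast$, $S_\alpha=S_{i_1}\circ\cdots\circ S_{i_k}$. Weak separation property (WSP): let $\mathcal E=\{S_\alpha^{-1}\circ S_\beta:\alpha,\beta\in\mathcal I^\ast,\alpha\ne\beta\}$, inside the group of similitudes with the topology of pointwise convergence. For $F$ not contained in any $(d-1)$-dimensional hyperplane, $\mathcal S$ satisfies the WSP if $I\notin\overline{\mathcal E\setminus\{I\}}$,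 where $I$ is the identity. Overlapping directions: $B(x,R)$ is the closed ball, $\|\cdot\|_\infty$ is the sup norm on $[0,1]^d$ and $\|\cdot\|_{\mathrm{op}}$ the Euclidean operator norm. Suppose $\mathcal S$ does not satisfy the WSP. Take any sequences $\alpha_k,\beta_k\in\mathcal I^\ast$ such that $\Phi_k:=S_{\alpha_k}^{-1}\circ S_{\beta_k}-I$ satisfies $0<\|\Phi_k\|_\infty\to0$ and such that, for some $a\in F$ and $\rho>0$, $\rho\|D\Phi_k\|_{\mathrm{op}}\le\|\Phi_k(a_k)\|$ for all $k$, where $a_k$ is any point of $B(a,\rho)$ minimizing $\|\Phi_k(x)\|$ over $x\in B(a,\rho)$. Any limit point $\omega\in S^{d-1}$ of $\{\Phi_k(a)/\|\Phi_k(a)\|\}_k$, for any such choice of data, is called an overlapping direction for $\mathcal S$. $V_{\mathcal S}$ is the vector subspace of $\mathbb{R}^d$ spanned by all overlapping directions for $\mathcal S$. Weak tangent: for nonempty compact $E,\hat E\subset\mathbb{R}^d$, $\hat E$ is a weak tangent of $E$ if there are a compact set $X\subset\mathbb{R}^d$ containing both $E$ and $\hat E$ and a sequence of similarity maps $T_k:\mathbb{R}^d\to\mathbb{R}^d$ such that $T_k(E)\cap X\to\hat E$ in the Hausdorff metric as $k\to\infty$. *)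

theory Defs
  imports "HOL-Analysis.Analysis"
begin

definition similitude_ratio :: "real \<Rightarrow> (real^'n \<Rightarrow> real^'n) \<Rightarrow> bool" where
  "similitude_ratio c f \<longleftrightarrow>
     0 < c \<and> (\<exists>Q b. orthogonal_matrix Q \<and> f = (\<lambda>x. c *\<^sub>R (Q *v x) + b))"

definition similitude :: "(real^'n \<Rightarrow> real^'n) \<Rightarrow> bool" where
  "similitude f \<longleftrightarrow> (\<exists>c. similitude_ratio c f)"

text \<open>An iterated function system is a family indexed by \<open>{1..m}\<close>; repetitions are allowed, and
  the values of \<open>S\<close> outside \<open>{1..m}\<close> are irrelevant.\<close>

definition ifs :: "nat \<Rightarrow> (nat \<Rightarrow> real^'n \<Rightarrow> real^'n) \<Rightarrow> bool" where
  "ifs m S \<longleftrightarrow> 1 \<le> m \<and> (\<forall>i\<in>{1..m}. \<exists>c<1. similitude_ratio c (S i))"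

definition is_attractor :: "nat \<Rightarrow> (nat \<Rightarrow> real^'n \<Rightarrow> real^'n) \<Rightarrow> (real^'n) set \<Rightarrow> bool" where
  "is_attractor m S F \<longleftrightarrow> F \<noteq> {} \<and> compact F \<and> F = (\<Union>i\<in>{1..m}. S i ` F)"

definition in_hyperplane :: "(real^'n) set \<Rightarrow> bool" where
  "in_hyperplane F \<longleftrightarrow> (\<exists>u c. u \<noteq> 0 \<and> F \<subseteq> {x. u \<bullet> x = c})"

definition words :: "nat \<Rightarrow> nat list set" where
  "words m = {\<alpha>. \<alpha> \<noteq> [] \<and> set \<alpha> \<subseteq> {1..m}}"

primrec word_map :: "(nat \<Rightarrow> 'a \<Rightarrow> 'a) \<Rightarrow> nat list \<Rightarrow> 'a \<Rightarrow> 'a" where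
  "word_map S [] = id"
| "word_map S (i # \<alpha>) = S i \<circ> word_map S \<alpha>"

definition overlap_maps :: "nat \<Rightarrow> (nat \<Rightarrow> real^'n \<Rightarrow> real^'n) \<Rightarrow> (real^'n \<Rightarrow> real^'n) set" where
  "overlap_maps m S =
     {inv (word_map S \<alpha>) \<circ> word_map S \<beta> | \<alpha> \<beta>. \<alpha> \<in> words m \<and> \<beta> \<in> words m \<and> \<alpha> \<noteq> \<beta>}"

text \<open>The topology on the function type is the product topology, i.e. that of pointwise
  convergence. The property is meant for systems whose attractor lies in no hyperplane.\<close>

definition weak_separation :: "nat \<Rightarrow> (nat \<Rightarrow> real^'n \<Rightarrow> real^'n) \<Rightarrow> bool" where
  "weak_separation m S \<longleftrightarrow>
     id \<notin> top_of_set {f. similitude f} closure_of (overlap_maps m S - {id})"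

definition sup_norm_cube :: "(real^'n \<Rightarrow> real^'n) \<Rightarrow> real" where
  "sup_norm_cube f = (SUP x\<in>cbox 0 1. norm (f x))"

text \<open>The maps \<open>\<Phi> k\<close> are affine, so their derivative does not depend on the point and is taken at
  the origin. A limit point of a sequence is a limit of one of its subsequences.\<close>

definition overlapping_direction ::
  "nat \<Rightarrow> (nat \<Rightarrow> real^'n \<Rightarrow> real^'n) \<Rightarrow> (real^'n) set \<Rightarrow> real^'n \<Rightarrow> bool" where
  "overlapping_direction m S F \<omega> \<longleftrightarrow>
     (\<exists>\<alpha> \<beta> \<Phi> a \<rho> p r.
        (\<forall>k::nat. \<alpha> k \<in> words m \<and> \<beta> k \<in> words m) \<and>
        (\<forall>k x. \<Phi> k x = (inv (word_map S (\<alpha> k)) \<circ> word_map S (\<beta> k)) x - x) \<and>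
        (\<forall>k. 0 < sup_norm_cube (\<Phi> k)) \<and>
        (\<lambda>k. sup_norm_cube (\<Phi> k)) \<longlonglongrightarrow> 0 \<and>
        a \<in> F \<and> 0 < \<rho> \<and>
        (\<forall>k. is_arg_min (\<lambda>x. norm (\<Phi> k x)) (\<lambda>x. x \<in> cball a \<rho>) (p k)) \<and>
        (\<forall>k. \<rho> * onorm (frechet_derivative (\<Phi> k) (at 0)) \<le> norm (\<Phi> k (p k))) \<and>
        strict_mono (r :: nat \<Rightarrow> nat) \<and>
        (\<lambda>k. \<Phi> (r k) a /\<^sub>R norm (\<Phi> (r k) a)) \<longlonglongrightarrow> \<omega> \<and>
        \<omega> \<in> sphere 0 1)"

definition overlap_space :: "nat \<Rightarrow> (nat \<Rightarrow> real^'n \<Rightarrow> real^'n) \<Rightarrow> (real^'n) set \<Rightarrow> (real^'n) set"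
  where "overlap_space m S F = span {\<omega>. overlapping_direction m S F \<omega>}"

text \<open>Meaningful as the Hausdorff metric for nonempty compact sets only.\<close>

definition hausdorff_dist :: "'a::metric_space set \<Rightarrow> 'a set \<Rightarrow> real" where
  "hausdorff_dist A B = max (SUP x\<in>A. infdist x B) (SUP y\<in>B. infdist y A)"

definition weak_tangent :: "(real^'n) set \<Rightarrow> (real^'n) set \<Rightarrow> bool" where
  "weak_tangent E G \<longleftrightarrow>
     E \<noteq> {} \<and> compact E \<and> G \<noteq> {} \<and> compact G \<and>
     (\<exists>X T. compact X \<and> E \<subseteq> X \<and> G \<subseteq> X \<and>
        (\<forall>k::nat. similitude (T k) \<and> T k ` E \<inter> X \<noteq> {}) \<and>
        (\<lambda>k. hausdorff_dist (T k ` E \<inter> X) G) \<longlonglongrightarrow> 0)"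

definition parallelotope :: "nat \<Rightarrow> (nat \<Rightarrow> real^'n) \<Rightarrow> (real^'n) set" where
  "parallelotope s \<omega> = {\<Sum>i=1..s. t i *\<^sub>R \<omega> i | t. \<forall>i\<in>{1..s}. 0 \<le> t i \<and> t i \<le> 1}"

end

theory Submission
  imports Defs "HOL-Complex_Analysis.Great_Picard"
begin

text \<open>Near a point of \<open>F\<close> the map \<open>inv S_\<alpha> \<circ> S_\<beta>\<close> of an overlapping direction \<open>\<omega>\<close> is, up to a
  small relative error, the translation by \<open>\<phi> \<omega>\<close> with \<open>\<phi>\<close> tiny. Conjugating it by a word that zooms
  into this point, and whose rotation is almost the identity, gives words whose maps differ on a
  prescribed ball by nearly the translation by \<open>t \<omega>\<close>, with \<open>t\<close> as small as desired but bounded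
  below. If \<open>inv S_\<sigma> ` F\<close> approximates \<open>V + F\<close>, then prepending such words \<open>\<alpha>\<close> to \<open>\<sigma>\<close> yields a blow-up
  \<open>inv S_(\<alpha>\<sigma>) ` F\<close> that approximates both \<open>V + F\<close> and \<open>V + t \<omega> + F\<close>; finitely many such steps fill
  in \<open>V + [0,1] \<omega> + F\<close>. Doing this for one direction after the other produces blow-ups of \<open>F\<close>
  approximating \<open>W + F\<close> arbitrarily well, and a Hausdorff limit of these is the weak tangent.\<close>

section \<open>Hausdorff convergence\<close>

lemma hausdorff_dist_le:
  assumes "A \<noteq> {}" "B \<noteq> {}"
    and "\<And>x. x \<in> A \<Longrightarrow> infdist x B \<le> e" and "\<And>y. y \<in> B \<Longrightarrow> infdist y A \<le> e"
  shows "hausdorff_dist A B \<le> e"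
  unfolding hausdorff_dist_def using assms by (auto intro!: cSUP_least)

text \<open>A real \<open>SUP\<close> carries information only for a set bounded above. Boundedness
  of \<open>A\<close> ensures this for the first supremum, and one nonnegative argument of
  \<open>max\<close> is enough.\<close>

lemma hausdorff_dist_nonneg:
  assumes "A \<noteq> {}" "bounded A" "B \<noteq> {}"
  shows "0 \<le> hausdorff_dist A B"
proof -
  obtain a b where a: "a \<in> A" and b: "b \<in> B"
    using assms by auto
  obtain M where M: "\<And>x. x \<in> A \<Longrightarrow> dist x b \<le> M"
    using assms(2) unfolding bounded_any_center[where a = b] by (auto simp: dist_commute)
  have "bdd_above ((\<lambda>x. infdist x B) ` A)"
    using M infdist_le[OF b] by (intro bdd_aboveI2[where M = M]) (meson order_trans)
  then have "infdist a B \<le> (SUP x\<in>A. infdist x B)"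
    by (rule cSUP_upper[OF a])
  with infdist_nonneg[of a B] show ?thesis
    unfolding hausdorff_dist_def by linarith
qed

text \<open>The distance functions of the sets are equi-Lipschitz, so a subsequence of them converges
  uniformly on \<open>X\<close>, and the zero set of the limit is the Hausdorff limit.\<close>

lemma hausdorff_convergent_subseq:
  fixes X :: "'a::euclidean_space set"
  assumes X: "compact X" and K: "\<And>n. K n \<subseteq> X" "\<And>n. K n \<noteq> {}"
  obtains r G where "strict_mono (r :: nat \<Rightarrow> nat)" "compact G" "G \<noteq> {}" "G \<subseteq> X"
    "(\<lambda>n. hausdorff_dist (K (r n)) G) \<longlonglongrightarrow> 0"
    "\<And>x. x \<in> X \<Longrightarrow> (\<lambda>n. infdist x (K n)) \<longlonglongrightarrow> 0 \<Longrightarrow> x \<in> G"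
proof -
  define D where "D n x = infdist x (K n)" for n x
  obtain M where M: "\<And>x y. x \<in> X \<Longrightarrow> y \<in> X \<Longrightarrow> dist x y \<le> M"
    using compact_imp_bounded[OF X] bounded_two_points by metis
  have D_le: "norm (D n x) \<le> M" if "x \<in> X" for n x
  proof -
    obtain k where k: "k \<in> K n" using K(2) by auto
    have "D n x \<le> dist x k" unfolding D_def by (rule infdist_le[OF k])
    also have "\<dots> \<le> M" using M that K(1) k by blast
    finally show ?thesis by (simp add: D_def infdist_nonneg)
  qed
  have D_lip: "\<bar>D n x - D n y\<bar> \<le> norm (x - y)" for n x y
    using infdist_triangle[of x "K n" y] infdist_triangle[of y "K n" x]
    by (auto simp: D_def dist_norm norm_minus_commute abs_le_iff)
  have equi: "\<exists>d. 0 < d \<and> (\<forall>n y. y \<in> X \<and> norm (x - y) < d \<longrightarrow> norm (D n x - D n y) < e)"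
    if "x \<in> X" "0 < e" for x e
    using that(2) le_less_trans[OF D_lip] by (intro exI[of _ e]) (simp add: real_norm_def)
  obtain g r where g: "continuous_on X g" and r: "strict_mono (r :: nat \<Rightarrow> nat)"
    and lim: "\<And>e. 0 < e \<Longrightarrow> \<exists>N. \<forall>n x. n \<ge> N \<and> x \<in> X \<longrightarrow> norm (D (r n) x - g x) < e"
    by (rule Arzela_Ascoli[OF X D_le equi]) auto
  have conv: "(\<lambda>n. D (r n) x) \<longlonglongrightarrow> g x" if "x \<in> X" for x
    using lim that unfolding LIMSEQ_iff by meson
  have g_nonneg: "0 \<le> g x" if "x \<in> X" for x
    using conv[OF that] by (rule LIMSEQ_le_const) (auto simp: D_def infdist_nonneg)
  \<comment> \<open>\<open>D (r n)\<close> vanishes on \<open>K (r n)\<close> and is uniformly close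
    to \<open>g\<close> there.\<close>
  have g_small: "\<exists>N. \<forall>n\<ge>N. \<forall>x\<in>K (r n). g x < e" if e: "0 < e" for e
  proof -
    obtain N where N: "\<forall>n x. n \<ge> N \<and> x \<in> X \<longrightarrow> norm (D (r n) x - g x) < e"
      using lim[OF e] by auto
    have "g x < e" if "n \<ge> N" "x \<in> K (r n)" for n x
    proof -
      have "x \<in> X" using K(1) that(2) by auto
      then have "\<bar>D (r n) x - g x\<bar> < e" using N that(1) by auto
      moreover have "D (r n) x = 0" using that(2) by (simp add: D_def)
      ultimately show ?thesis by simp
    qed
    then show ?thesis by blast
  qed
  define G where "G = {x \<in> X. g x = 0}"
  have GX: "G \<subseteq> X" by (auto simp: G_def)
  have cG: "compact G"
  proof -
    have "closed G"
      unfolding G_def using continuous_closed_preimage_constant[OF g compact_imp_closed[OF X]] .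
    with compact_Int_closed[OF X, of G] GX show ?thesis by (simp add: Int_absorb1)
  qed
  \<comment> \<open>The minimum of \<open>g\<close> over the compact \<open>X\<close> is attained;
    since the \<open>K n\<close> are nonempty, \<open>g_small\<close> forces it to be 0.\<close>
  have neG: "G \<noteq> {}"
  proof -
    have "X \<noteq> {}" using K by blast
    then obtain x where x: "x \<in> X" "\<forall>y\<in>X. g x \<le> g y"
      using continuous_attains_inf[OF X _ g] by blast
    have "g x \<le> e" if e: "0 < e" for e
    proof -
      obtain N where "\<forall>n\<ge>N. \<forall>y\<in>K (r n). g y < e" using g_small[OF e] by auto
      moreover obtain y where "y \<in> K (r N)" using K(2) by auto
      ultimately show ?thesis using x(2) K(1) by (meson less_eq_real_def order.trans order_refl subsetD)
    qed
    then have "g x \<le> 0" by (meson dense not_le)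
    with g_nonneg[OF x(1)] x(1) show ?thesis by (auto simp: G_def)
  qed
  \<comment> \<open>On the compact set of points of \<open>X\<close> at distance at least
    \<open>e\<close> from \<open>G\<close>, the positive function \<open>g\<close> has a positive
    minimum.\<close>
  have near: "\<exists>d>0. \<forall>x\<in>X. g x < d \<longrightarrow> infdist x G < e" if e: "0 < e" for e
  proof -
    define Y where "Y = X \<inter> {x. e \<le> infdist x G}"
    have "closed {x. e \<le> infdist x G}"
      by (intro closed_Collect_le continuous_intros)
    then have cY: "compact Y" unfolding Y_def using X by (rule compact_Int_closed[rotated])
    show ?thesis
    proof (cases "Y = {}")
      case True
      then show ?thesis by (intro exI[of _ 1]) (force simp: Y_def)
    next
      case False
      have "continuous_on Y g" using g by (rule continuous_on_subset) (auto simp: Y_def)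
      then obtain y where y: "y \<in> Y" "\<forall>x\<in>Y. g y \<le> g x"
        using continuous_attains_inf[OF cY False] by blast
      have "y \<notin> G" using y(1) e by (auto simp: Y_def)
      with y(1) g_nonneg[of y] have "0 < g y" by (force simp: Y_def G_def)
      then show ?thesis using y(2) by (intro exI[of _ "g y"]) (force simp: Y_def)
    qed
  qed
  have "(\<lambda>n. hausdorff_dist (K (r n)) G) \<longlonglongrightarrow> 0"
  proof (rule LIMSEQ_I)
    fix e :: real assume "0 < e"
    then have e: "0 < e/2" by simp
    obtain d where d: "d > 0" "\<forall>x\<in>X. g x < d \<longrightarrow> infdist x G < e/2" using near[OF e] by auto
    obtain N1 where N1: "\<forall>n\<ge>N1. \<forall>x\<in>K (r n). g x < d" using g_small[OF d(1)] by auto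
    obtain N2 where N2: "\<forall>n x. n \<ge> N2 \<and> x \<in> X \<longrightarrow> norm (D (r n) x - g x) < e/2"
      using lim[OF e] by auto
    have "norm (hausdorff_dist (K (r n)) G - 0) < e" if n: "n \<ge> max N1 N2" for n
    proof -
      have "infdist x G \<le> e/2" if "x \<in> K (r n)" for x
        using that d(2) N1 n K(1) by (meson less_imp_le max.bounded_iff subsetD)
      moreover have "infdist x (K (r n)) \<le> e/2" if "x \<in> G" for x
        using that N2 n unfolding G_def D_def by force
      ultimately have "hausdorff_dist (K (r n)) G \<le> e/2"
        using K(2) neG by (intro hausdorff_dist_le)
      moreover have "0 \<le> hausdorff_dist (K (r n)) G"
        using K(2) neG bounded_subset[OF compact_imp_bounded[OF X] K(1)]
        by (intro hausdorff_dist_nonneg)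
      ultimately show ?thesis using e by simp
    qed
    then show "\<exists>N. \<forall>n\<ge>N. norm (hausdorff_dist (K (r n)) G - 0) < e" by blast
  qed
  moreover have "x \<in> G" if "x \<in> X" "(\<lambda>n. infdist x (K n)) \<longlonglongrightarrow> 0" for x
    using LIMSEQ_unique[OF conv[OF that(1)]] LIMSEQ_subseq_LIMSEQ[OF that(2) r] that(1)
    by (force simp: G_def D_def o_def)
  ultimately show ?thesis using that r cG neG GX by blast
qed

section \<open>Similitudes and affine maps\<close>

text \<open>The isometric part is packed as a \<open>blinfun\<close> because bounded sets of these
  are precompact in operator norm, which the recurrence of rotations relies on.\<close>

lemma similitude_ratio_blinfun:
  assumes "similitude_ratio c f"
  obtains L b where "\<And>x. norm (blinfun_apply L x) = norm x" "\<And>x. f x = c *\<^sub>R blinfun_apply L x + b"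
proof -
  obtain Q b where Q: "orthogonal_matrix Q" "f = (\<lambda>x. c *\<^sub>R (Q *v x) + b)"
    using assms unfolding similitude_ratio_def by auto
  have L: "blinfun_apply (Blinfun ((*v) Q)) = (*v) Q"
    by (simp add: bounded_linear_Blinfun_apply matrix_vector_mul_bounded_linear)
  have "orthogonal_transformation ((*v) Q)"
    using Q(1) by (simp add: orthogonal_transformation_matrix)
  then have "norm (Q *v x) = norm x" for x
    by (rule orthogonal_transformation_norm)
  then show ?thesis
    using that[of "Blinfun ((*v) Q)" b] Q(2) L by simp
qed

lemma similitude_id: "similitude id"
  unfolding similitude_def similitude_ratio_def
  by (intro exI[of _ 1] conjI exI[of _ "mat 1"] exI[of _ 0])
    (auto simp: orthogonal_matrix_id)

lemma similitude_comp:
  assumes "similitude f" "similitude g" shows "similitude (f \<circ> g)"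
proof -
  obtain c P a where f: "0 < c" "orthogonal_matrix P" "f = (\<lambda>x. c *\<^sub>R (P *v x) + a)"
    using assms(1) unfolding similitude_def similitude_ratio_def by auto
  obtain d Q b where g: "0 < d" "orthogonal_matrix Q" "g = (\<lambda>x. d *\<^sub>R (Q *v x) + b)"
    using assms(2) unfolding similitude_def similitude_ratio_def by auto
  have "f \<circ> g = (\<lambda>x. (c * d) *\<^sub>R ((P ** Q) *v x) + (c *\<^sub>R (P *v b) + a))"
    by (auto simp: f g fun_eq_iff matrix_vector_right_distrib matrix_vector_mult_scaleR
        matrix_vector_mul_assoc[symmetric] scaleR_add_right)
  moreover have "orthogonal_matrix (P ** Q)" "0 < c * d"
    using f g by (simp_all add: orthogonal_matrix_mul)
  ultimately show ?thesis
    unfolding similitude_def similitude_ratio_def by blast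
qed

lemma similitude_inv:
  assumes "similitude f" shows "similitude (inv f)"
proof -
  obtain c P a where f: "0 < c" "orthogonal_matrix P" "f = (\<lambda>x. c *\<^sub>R (P *v x) + a)"
    using assms unfolding similitude_def similitude_ratio_def by auto
  define g where "g x = inverse c *\<^sub>R (transpose P *v x) + - (inverse c *\<^sub>R (transpose P *v a))" for x
  have P: "P ** transpose P = mat 1" "transpose P ** P = mat 1"
    using f(2) by (simp_all add: orthogonal_matrix_def)
  have "inv f = g"
    using f(1) P by (intro inv_unique_comp)
      (auto simp: g_def f(3) fun_eq_iff matrix_vector_right_distrib matrix_vector_mult_scaleR
        matrix_vector_mul_assoc scaleR_add_right matrix_vector_mult_diff_distrib
        scaleR_right_diff_distrib simp del: transpose_matrix_vector)
  moreover have "similitude g"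
    unfolding similitude_def similitude_ratio_def
    using f(1,2) orthogonal_matrix_transpose[of P]
    by (intro exI[of _ "inverse c"] conjI exI[of _ "transpose P"]
        exI[of _ "- (inverse c *\<^sub>R (transpose P *v a))"]) (auto simp: g_def)
  ultimately show ?thesis by simp
qed

lemma similitude_word_map:
  "(\<And>i. i \<in> set w \<Longrightarrow> similitude (S i)) \<Longrightarrow> similitude (word_map S w)"
  by (induction w) (simp_all add: similitude_id similitude_comp)

text \<open>An affine map is determined by its values at the vertices 0 and \<open>axis i 1\<close>
  of the cube. This carries smallness in the sup norm on the cube over to a base point outside
  it.\<close>

lemma affine_bounded_by_cube:
  fixes A :: "real^'n \<Rightarrow> real^'n"
  assumes A: "bounded_linear A"
  shows "norm (A x + b) \<le> (1 + 2 * (\<Sum>i\<in>UNIV. \<bar>x $ i\<bar>)) * sup_norm_cube (\<lambda>x. A x + b)"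
proof -
  let ?M = "sup_norm_cube (\<lambda>x. A x + b)"
  interpret A: bounded_linear A by (rule A)
  have "continuous_on (cbox 0 1) (\<lambda>x. norm (A x + b))"
    by (intro continuous_intros A.continuous_on)
  then have "bdd_above ((\<lambda>x. norm (A x + b)) ` cbox 0 1)"
    by (intro bounded_imp_bdd_above compact_imp_bounded compact_continuous_image compact_cbox)
  then have le: "norm (A y + b) \<le> ?M" if "y \<in> cbox 0 1" for y
    unfolding sup_norm_cube_def using that by (rule cSUP_upper[rotated])
  have b: "norm b \<le> ?M"
    using le[of 0] by (simp add: A.zero mem_box_cart)
  have ax: "norm (A (axis i 1)) \<le> 2 * ?M" for i
  proof -
    have "axis i 1 \<in> cbox (0::real^'n) 1"
      by (auto simp: mem_box_cart axis_def)
    from le[OF this] b show ?thesis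
      using norm_triangle_ineq4[of "A (axis i 1) + b" b] by simp
  qed
  have "A x = A (\<Sum>i\<in>UNIV. x $ i *\<^sub>R axis i 1)"
    using basis_expansion[of x] by (simp add: scalar_mult_eq_scaleR)
  also have "\<dots> = (\<Sum>i\<in>UNIV. x $ i *\<^sub>R A (axis i 1))"
    by (simp add: A.sum A.scaleR)
  finally have "norm (A x) \<le> (\<Sum>i\<in>UNIV. norm (x $ i *\<^sub>R A (axis i 1)))"
    by (simp only: norm_sum)
  also have "\<dots> \<le> (\<Sum>i\<in>UNIV. \<bar>x $ i\<bar> * (2 * ?M))"
    by (intro sum_mono) (simp add: mult_left_mono[OF ax])
  finally have "norm (A x) \<le> (\<Sum>i\<in>UNIV. \<bar>x $ i\<bar>) * (2 * ?M)"
    by (simp add: sum_distrib_right)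
  with b norm_triangle_ineq[of "A x" b] show ?thesis
    by (simp add: algebra_simps)
qed

section \<open>Word maps and their rotations\<close>

primrec word_ratio :: "(nat \<Rightarrow> real) \<Rightarrow> nat list \<Rightarrow> real" where
  "word_ratio c [] = 1"
| "word_ratio c (i # w) = c i * word_ratio c w"

text \<open>The ratios are left out, so that these operators are isometries and form a bounded
  set.\<close>

primrec word_lin :: "(nat \<Rightarrow> 'a \<Rightarrow>\<^sub>L 'a) \<Rightarrow> nat list \<Rightarrow> 'a::real_normed_vector \<Rightarrow>\<^sub>L 'a" where
  "word_lin L [] = id_blinfun"
| "word_lin L (i # w) = L i o\<^sub>L word_lin L w"

lemma word_map_append: "word_map S (u @ v) = word_map S u \<circ> word_map S v"
  by (induction u) auto

lemma word_ratio_append: "word_ratio c (u @ v) = word_ratio c u * word_ratio c v"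
  by (induction u) auto

lemma word_lin_append: "word_lin L (u @ v) = word_lin L u o\<^sub>L word_lin L v"
  by (induction u) (auto intro!: blinfun_eqI)

text \<open>Fixes one choice of the ratios, linear parts and translations whose existence
  \<open>ifs\<close> asserts.\<close>

locale ifs_attractor =
  fixes m :: nat and S :: "nat \<Rightarrow> real^'n \<Rightarrow> real^'n" and F :: "(real^'n) set"
    and c :: "nat \<Rightarrow> real" and L :: "nat \<Rightarrow> (real^'n) \<Rightarrow>\<^sub>L (real^'n)" and b :: "nat \<Rightarrow> real^'n"
  assumes S_eq: "\<And>i x. i \<in> {1..m} \<Longrightarrow> S i x = c i *\<^sub>R L i x + b i"
    and c_pos: "\<And>i. i \<in> {1..m} \<Longrightarrow> 0 < c i"
    and c_less: "\<And>i. i \<in> {1..m} \<Longrightarrow> c i < 1"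
    and norm_L: "\<And>i x. i \<in> {1..m} \<Longrightarrow> norm (L i x) = norm x"
    and ifs: "ifs m S"
    and attr: "is_attractor m S F"
begin

lemma m_pos: "1 \<le> m"
  using ifs by (simp add: ifs_def)

lemma word_ratio_pos: "set w \<subseteq> {1..m} \<Longrightarrow> 0 < word_ratio c w"
  by (induction w) (auto intro!: mult_pos_pos c_pos)

lemma norm_word_lin: "set w \<subseteq> {1..m} \<Longrightarrow> norm (word_lin L w x) = norm x"
  by (induction w) (auto simp: norm_L)

lemma word_map_diff:
  "set w \<subseteq> {1..m} \<Longrightarrow> word_map S w x - word_map S w y = word_ratio c w *\<^sub>R word_lin L w (x - y)"
proof (induction w)
  case (Cons i w)
  then have i: "i \<in> {1..m}" by auto
  have "word_map S (i # w) x - word_map S (i # w) y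
      = c i *\<^sub>R L i (word_map S w x - word_map S w y)"
    by (simp add: S_eq[OF i] blinfun.diff_right scaleR_diff_right)
  also have "\<dots> = word_ratio c (i # w) *\<^sub>R word_lin L (i # w) (x - y)"
    using Cons by (simp add: blinfun.scaleR_right)
  finally show ?case .
qed simp

lemma dist_word_map:
  "set w \<subseteq> {1..m} \<Longrightarrow> dist (word_map S w x) (word_map S w y) = word_ratio c w * dist x y"
  using word_ratio_pos[of w] by (simp add: dist_norm word_map_diff norm_word_lin)

lemma surj_word_lin:
  assumes "set w \<subseteq> {1..m}" shows "surj (word_lin L w)"
proof (rule linear_inj_imp_surj)
  show lin: "linear (word_lin L w)"
    by (simp add: blinfun.bounded_linear_right bounded_linear.linear)
  show "inj (word_lin L w)"
    unfolding linear_injective_0[OF lin]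
    using norm_word_lin[OF assms] by (metis norm_eq_zero)
qed

lemma bij_word_map:
  assumes w: "set w \<subseteq> {1..m}" shows "bij (word_map S w)"
proof (rule bijI)
  show "inj (word_map S w)"
  proof (rule injI)
    fix x y assume "word_map S w x = word_map S w y"
    then show "x = y"
      using dist_word_map[OF w, of x y] word_ratio_pos[OF w] by simp
  qed
  show "surj (word_map S w)"
  proof (rule surjI)
    fix z
    show "word_map S w (SOME x. word_map S w x = z) = z"
    proof (rule someI_ex)
      obtain u where "word_lin L w u = (z - word_map S w 0) /\<^sub>R word_ratio c w"
        using surj_word_lin[OF w] by (metis surjD)
      then have "word_map S w u = z"
        using word_map_diff[OF w, of u 0] word_ratio_pos[OF w] by simp
      then show "\<exists>x. word_map S w x = z" ..
    qed
  qed
qed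

lemma word_map_attractor: "set w \<subseteq> {1..m} \<Longrightarrow> x \<in> F \<Longrightarrow> word_map S w x \<in> F"
proof (induction w)
  case (Cons i w)
  moreover have "F = (\<Union>i\<in>{1..m}. S i ` F)" using attr by (simp add: is_attractor_def)
  ultimately show ?case by fastforce
qed simp

text \<open>Powers of an isometry accumulate, hence return to the identity.\<close>

lemma word_lin_recurrent:
  assumes w: "set w \<subseteq> {1..m}" and e: "0 < e"
  obtains p where "set p \<subseteq> {1..m}" "\<And>z. norm (word_lin L p (word_lin L w z) - z) \<le> e * norm z"
proof -
  define W where "W n = concat (replicate n w)" for n
  have W: "set (W n) \<subseteq> {1..m}" for n
    using w by (auto simp: W_def)
  have W_add: "W (i + j) = W i @ W j" for i j
    by (simp add: W_def replicate_add)
  have "bounded (range (\<lambda>n. word_lin L (W n)))"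
    unfolding bounded_iff
    by (intro exI[of _ 1]) (auto intro!: norm_blinfun_bound simp: norm_word_lin[OF W])
  then obtain l r where r: "strict_mono (r :: nat \<Rightarrow> nat)"
    and "((\<lambda>n. word_lin L (W n)) \<circ> r) \<longlonglongrightarrow> l"
    using bounded_imp_convergent_subsequence by blast
  then have "Cauchy ((\<lambda>n. word_lin L (W n)) \<circ> r)"
    by (intro LIMSEQ_imp_Cauchy)
  then obtain N where N: "dist (word_lin L (W (r (Suc N)))) (word_lin L (W (r N))) < e"
    using e unfolding Cauchy_def by (metis comp_apply le_SucI order_refl)
  \<comment> \<open>Writing the positive gap of the exponents as \<open>Suc q\<close> splits off one
    copy of \<open>w\<close>; the remaining power \<open>W q\<close> is what nearly undoes
    \<open>w\<close>.\<close>
  obtain q where q: "r (Suc N) = r N + Suc q"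
    using r by (metis less_iff_Suc_add lessI strict_mono_less add_Suc_right)
  show ?thesis
  proof
    show "set (W q) \<subseteq> {1..m}" by (rule W)
    fix z
    have S: "W (Suc q) = W q @ w"
      using W_add[of q 1] by (simp add: W_def)
    \<comment> \<open>Applying the isometry of \<open>W (r N)\<close> keeps the norm and produces
      the difference of two close terms of the Cauchy sequence.\<close>
    have "norm (word_lin L (W q) (word_lin L w z) - z)
        = norm (word_lin L (W (r N)) (word_lin L (W q) (word_lin L w z) - z))"
      by (simp add: norm_word_lin[OF W])
    also have "\<dots> = norm ((word_lin L (W (r (Suc N))) - word_lin L (W (r N))) z)"
      by (simp add: q W_add[of "r N" "Suc q"] S word_lin_append blinfun.diff_right blinfun.diff_left
          del: add_Suc_right)
    also have "\<dots> \<le> norm (word_lin L (W (r (Suc N))) - word_lin L (W (r N))) * norm z"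
      by (rule norm_blinfun)
    also have "\<dots> \<le> e * norm z"
      using N by (intro mult_right_mono) (auto simp: dist_norm)
    finally show "norm (word_lin L (W q) (word_lin L w z) - z) \<le> e * norm z" .
  qed
qed

text \<open>Precompactness of the set of linear parts makes finitely many return words suffice.\<close>

lemma finite_return_words:
  assumes e: "0 < e"
  obtains P where "finite P" "P \<noteq> {}" "\<And>p. p \<in> P \<Longrightarrow> set p \<subseteq> {1..m}"
    "\<And>w. set w \<subseteq> {1..m} \<Longrightarrow>
       \<exists>p\<in>P. \<forall>z. norm (word_lin L p (word_lin L w z) - z) \<le> e * norm z"
proof -
  let ?A = "word_lin L ` {w. set w \<subseteq> {1..m}}"
  have "bounded ?A"
    unfolding bounded_iff
    by (intro exI[of _ 1]) (auto intro!: norm_blinfun_bound simp: norm_word_lin)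
  then have "compact (closure ?A)"
    by (simp add: compact_closure)
  \<comment> \<open>Balls centred at elements of \<open>?A\<close> already cover the closure, so the
    centres of a finite subcover come from actual words.\<close>
  moreover have "closure ?A \<subseteq> (\<Union>x\<in>?A. ball x (e/2))"
  proof
    fix y assume "y \<in> closure ?A"
    then have "\<exists>x\<in>?A. dist x y < e/2" using e unfolding closure_approachable by (metis half_gt_zero)
    then show "y \<in> (\<Union>x\<in>?A. ball x (e/2))" by auto
  qed
  ultimately obtain A' where A': "A' \<subseteq> ?A" "finite A'" "closure ?A \<subseteq> (\<Union>x\<in>A'. ball x (e/2))"
    using compactE_image[of "closure ?A" ?A "\<lambda>x. ball x (e/2)"] by (metis open_ball)
  obtain V where V: "V \<subseteq> {w. set w \<subseteq> {1..m}}" "finite V" "A' = word_lin L ` V"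
    using finite_subset_image[OF A'(2,1)] by blast
  have e2: "0 < e/2" using e by simp
  have "\<forall>v\<in>V. \<exists>p. set p \<subseteq> {1..m} \<and> (\<forall>z. norm (word_lin L p (word_lin L v z) - z) \<le> e/2 * norm z)"
  proof
    fix v assume "v \<in> V"
    then have "set v \<subseteq> {1..m}" using V(1) by auto
    then obtain p where "set p \<subseteq> {1..m}"
      "\<And>z. norm (word_lin L p (word_lin L v z) - z) \<le> e/2 * norm z"
      using word_lin_recurrent[OF _ e2] by metis
    then show "\<exists>p. set p \<subseteq> {1..m} \<and> (\<forall>z. norm (word_lin L p (word_lin L v z) - z) \<le> e/2 * norm z)"
      by blast
  qed
  then obtain p where p: "\<And>v. v \<in> V \<Longrightarrow> set (p v) \<subseteq> {1..m}"
    "\<And>v z. v \<in> V \<Longrightarrow> norm (word_lin L (p v) (word_lin L v z) - z) \<le> e/2 * norm z"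
    by metis
  show ?thesis
  proof
    show "finite (p ` V)" using V(2) by simp
    have "word_lin L [] \<in> closure ?A" by (rule subsetD[OF closure_subset]) (rule imageI, simp)
    then show "p ` V \<noteq> {}" using A'(3) V(3) by auto
    show "set q \<subseteq> {1..m}" if "q \<in> p ` V" for q using that p(1) by auto
    fix w assume w: "set w \<subseteq> {1..m}"
    then have "word_lin L w \<in> closure ?A" by (intro subsetD[OF closure_subset]) auto
    then obtain v where v: "v \<in> V" "dist (word_lin L v) (word_lin L w) < e/2"
      using A'(3) V(3) by auto
    \<comment> \<open>The return word of \<open>v\<close> serves the nearby \<open>w\<close> as
      well: half of \<open>e\<close> pays for replacing \<open>w\<close> by \<open>v\<close>, the
      other half for the return of \<open>v\<close>.\<close>
    have "norm (word_lin L (p v) (word_lin L w z) - z) \<le> e * norm z" for z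
    proof -
      have "norm (word_lin L (p v) (word_lin L w z) - z)
          \<le> norm (word_lin L (p v) (word_lin L w z) - word_lin L (p v) (word_lin L v z))
            + norm (word_lin L (p v) (word_lin L v z) - z)"
        using norm_triangle_ineq[of "word_lin L (p v) (word_lin L w z) - word_lin L (p v) (word_lin L v z)"
            "word_lin L (p v) (word_lin L v z) - z"] by simp
      also have "norm (word_lin L (p v) (word_lin L w z) - word_lin L (p v) (word_lin L v z))
          = norm ((word_lin L w - word_lin L v) z)"
        by (metis blinfun.diff_left blinfun.diff_right norm_word_lin p(1) v(1))
      also have "\<dots> \<le> norm (word_lin L w - word_lin L v) * norm z" by (rule norm_blinfun)
      also have "\<dots> \<le> e/2 * norm z"
        using v(2) by (intro mult_right_mono) (auto simp: dist_norm norm_minus_commute)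
      finally show ?thesis using p(2)[OF v(1), of z] by simp
    qed
    then show "\<exists>q\<in>p ` V. \<forall>z. norm (word_lin L q (word_lin L w z) - z) \<le> e * norm z"
      using v(1) by blast
  qed
qed

section \<open>Near-translations from overlapping directions\<close>

lemma similitude_word:
  assumes "set w \<subseteq> {1..m}" shows "similitude (word_map S w)"
  using assms ifs by (intro similitude_word_map) (auto simp: ifs_def similitude_def)

text \<open>Here \<phi> is the norm of \<open>\<Phi> k a\<close>. The derivative bound lets
  \<open>\<Phi> k\<close> vary near \<open>a\<close> only by a small multiple of \<phi>, on a ball
  whose radius does not shrink with \<theta>. Stating the result through \<open>y\<close> keeps
  \<open>inv\<close> out of later arguments.\<close>

lemma overlap_near_translation:
  assumes od: "overlapping_direction m S F \<omega>" and e: "0 < e"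
  obtains a \<delta> where "a \<in> F" "0 < \<delta>"
    "\<And>\<theta>. 0 < \<theta> \<Longrightarrow> \<exists>\<alpha> \<beta> \<phi>. set \<alpha> \<subseteq> {1..m} \<and> set \<beta> \<subseteq> {1..m} \<and> 0 < \<phi> \<and> \<phi> < \<theta> \<and>
       (\<forall>x\<in>cball a \<delta>. \<exists>y. word_map S \<alpha> y = word_map S \<beta> x \<and> norm (y - x - \<phi> *\<^sub>R \<omega>) \<le> e * \<phi>)"
proof -
  obtain \<alpha> \<beta> \<Phi> a \<rho> p r where
    *: "(\<forall>k::nat. \<alpha> k \<in> words m \<and> \<beta> k \<in> words m) \<and>
        (\<forall>k x. \<Phi> k x = (inv (word_map S (\<alpha> k)) \<circ> word_map S (\<beta> k)) x - x) \<and>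
        (\<forall>k. 0 < sup_norm_cube (\<Phi> k)) \<and>
        (\<lambda>k. sup_norm_cube (\<Phi> k)) \<longlonglongrightarrow> 0 \<and>
        a \<in> F \<and> 0 < \<rho> \<and>
        (\<forall>k. is_arg_min (\<lambda>x. norm (\<Phi> k x)) (\<lambda>x. x \<in> cball a \<rho>) (p k)) \<and>
        (\<forall>k. \<rho> * onorm (frechet_derivative (\<Phi> k) (at 0)) \<le> norm (\<Phi> k (p k))) \<and>
        strict_mono (r :: nat \<Rightarrow> nat) \<and>
        (\<lambda>k. \<Phi> (r k) a /\<^sub>R norm (\<Phi> (r k) a)) \<longlonglongrightarrow> \<omega> \<and>
        \<omega> \<in> sphere 0 1"
    using od unfolding overlapping_direction_def by (elim exE) (rule that)
  have words: "\<alpha> k \<in> words m \<and> \<beta> k \<in> words m"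
    and \<Phi>: "\<Phi> k x = (inv (word_map S (\<alpha> k)) \<circ> word_map S (\<beta> k)) x - x"
    and pos: "0 < sup_norm_cube (\<Phi> k)"
    and p: "is_arg_min (\<lambda>x. norm (\<Phi> k x)) (\<lambda>x. x \<in> cball a \<rho>) (p k)"
    and D: "\<rho> * onorm (frechet_derivative (\<Phi> k) (at 0)) \<le> norm (\<Phi> k (p k))" for k x
    using * by blast+
  have to0: "(\<lambda>k. sup_norm_cube (\<Phi> k)) \<longlonglongrightarrow> 0"
    and a: "a \<in> F" and \<rho>: "0 < \<rho>" and r: "strict_mono r"
    and lim: "(\<lambda>k. \<Phi> (r k) a /\<^sub>R norm (\<Phi> (r k) a)) \<longlonglongrightarrow> \<omega>"
    using * by blast+
  have w: "set (\<alpha> k) \<subseteq> {1..m}" "set (\<beta> k) \<subseteq> {1..m}" for k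
    using words[of k] by (auto simp: words_def)
  have affine: "\<exists>A b. bounded_linear A \<and> \<Phi> k = (\<lambda>x. A x + b)" for k
  proof -
    have "similitude (inv (word_map S (\<alpha> k)) \<circ> word_map S (\<beta> k))"
      by (intro similitude_comp similitude_inv similitude_word w)
    then obtain c where
      "similitude_ratio c (inv (word_map S (\<alpha> k)) \<circ> word_map S (\<beta> k))"
      unfolding similitude_def by auto
    then obtain L b where
      "\<And>x. (inv (word_map S (\<alpha> k)) \<circ> word_map S (\<beta> k)) x = c *\<^sub>R blinfun_apply L x + b"
      by (rule similitude_ratio_blinfun) blast
    then have "\<Phi> k = (\<lambda>x. (c *\<^sub>R blinfun_apply L x - x) + b)"
      by (intro ext) (simp add: \<Phi> del: o_apply)
    moreover have "bounded_linear (\<lambda>x. c *\<^sub>R blinfun_apply L x - x)"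
      by (intro bounded_linear_intros blinfun.bounded_linear_right)
    ultimately show ?thesis by blast
  qed
  then obtain A b where A: "\<And>k. bounded_linear (A k)" and \<Phi>_A: "\<And>k. \<Phi> k = (\<lambda>x. A k x + b k)"
    by metis
  \<comment> \<open>The minimum over the ball is at most the value at its centre, so the bound
    assumed at \<open>p k\<close> holds at \<open>a\<close>.\<close>
  have A_le: "\<rho> * onorm (A k) \<le> norm (\<Phi> k a)" for k
  proof -
    have "(\<Phi> k has_derivative A k) (at 0)"
      unfolding \<Phi>_A using bounded_linear_imp_has_derivative[OF A] by (rule has_derivative_add_const)
    then have "frechet_derivative (\<Phi> k) (at 0) = A k"
      by (rule frechet_derivative_at[symmetric])
    moreover have "norm (\<Phi> k (p k)) \<le> norm (\<Phi> k a)"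
      using p[of k] \<rho> by (force simp: is_arg_min_def not_less)
    ultimately show ?thesis using D[of k] by simp
  qed
  have diff: "\<Phi> k x - \<Phi> k y = A k (x - y)" for k x y
    by (simp add: \<Phi>_A linear_diff[OF bounded_linear.linear[OF A]])
  have near: "norm (\<Phi> k x - \<Phi> k a) \<le> norm (\<Phi> k a) / \<rho> * norm (x - a)" for k x
  proof -
    have "norm (\<Phi> k x - \<Phi> k a) \<le> onorm (A k) * norm (x - a)"
      unfolding diff by (rule onorm[OF A])
    also have "\<dots> \<le> norm (\<Phi> k a) / \<rho> * norm (x - a)"
      using A_le[of k] \<rho> by (intro mult_right_mono) (auto simp: field_simps)
    finally show ?thesis .
  qed
  \<comment> \<open>If \<open>\<Phi> k\<close> vanished at \<open>a\<close>, then
    \<open>near\<close> would make it vanish everywhere, against its positive sup norm.\<close>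
  have \<Phi>_pos: "0 < norm (\<Phi> k a)" for k
  proof (rule ccontr)
    assume "\<not> 0 < norm (\<Phi> k a)"
    then have "\<Phi> k x = 0" for x using near[of k x] by simp
    then have "sup_norm_cube (\<Phi> k) = (SUP x\<in>cbox (0::real^'n) 1. 0)"
      by (simp add: sup_norm_cube_def)
    moreover have "0 \<in> cbox (0::real^'n) 1" by (simp add: mem_box_cart)
    then have "(SUP x\<in>cbox (0::real^'n) 1. 0 :: real) = 0" by (intro cSUP_const) blast
    ultimately have "sup_norm_cube (\<Phi> k) = 0" by simp
    with pos[of k] show False by simp
  qed
  have "(\<lambda>k. (1 + 2 * (\<Sum>i\<in>UNIV. \<bar>a $ i\<bar>)) * sup_norm_cube (\<Phi> k)) \<longlonglongrightarrow> 0"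
    using tendsto_mult_right_zero[OF to0] by simp
  then have "(\<lambda>k. norm (\<Phi> k a)) \<longlonglongrightarrow> 0"
    by (rule tendsto_sandwich[OF _ _ tendsto_const, rotated 2])
      (use affine_bounded_by_cube[OF A] in \<open>auto simp: \<Phi>_A\<close>)
  then have \<Phi>_to0: "(\<lambda>k. norm (\<Phi> (r k) a)) \<longlonglongrightarrow> 0"
    using LIMSEQ_subseq_LIMSEQ[OF _ r] by (force simp: o_def)
  show ?thesis
  proof
    show "a \<in> F" by (rule a)
    \<comment> \<open>This radius limits the variation of \<open>\<Phi> k\<close> to
      \<open>\<phi> * (e / 2)\<close>; the other half of the error is spent on the direction of
      \<open>\<Phi> k a\<close>.\<close>
    show "0 < e / 2 * \<rho>" using e \<rho> by simp
    fix \<theta> :: real assume \<theta>: "0 < \<theta>"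
    have "\<forall>\<^sub>F k in sequentially. norm (\<Phi> (r k) a) < \<theta> \<and> dist (\<Phi> (r k) a /\<^sub>R norm (\<Phi> (r k) a)) \<omega> < e/2"
      using order_tendstoD(2)[OF \<Phi>_to0 \<theta>] tendstoD[OF lim, of "e/2"] e
      by (simp add: eventually_conj)
    then obtain k' where "norm (\<Phi> (r k') a) < \<theta> \<and> dist (\<Phi> (r k') a /\<^sub>R norm (\<Phi> (r k') a)) \<omega> < e/2"
      using eventually_happens'[OF sequentially_bot] by blast
    then obtain k where k: "norm (\<Phi> k a) < \<theta>" "dist (\<Phi> k a /\<^sub>R norm (\<Phi> k a)) \<omega> < e/2" by blast
    define \<phi> where "\<phi> = norm (\<Phi> k a)"
    have \<phi>: "0 < \<phi>" using \<Phi>_pos by (simp add: \<phi>_def)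
    have "\<Phi> k a - \<phi> *\<^sub>R \<omega> = \<phi> *\<^sub>R (\<Phi> k a /\<^sub>R \<phi> - \<omega>)"
      using \<phi> by (simp add: scaleR_diff_right)
    then have "norm (\<Phi> k a - \<phi> *\<^sub>R \<omega>) = \<phi> * dist (\<Phi> k a /\<^sub>R \<phi>) \<omega>"
      using \<phi> by (simp add: dist_norm)
    also have "\<dots> \<le> \<phi> * (e / 2)"
      using k(2) \<phi> by (intro mult_left_mono) (auto simp: \<phi>_def)
    finally have 1: "norm (\<Phi> k a - \<phi> *\<^sub>R \<omega>) \<le> \<phi> * (e / 2)" .
    have "\<exists>y. word_map S (\<alpha> k) y = word_map S (\<beta> k) x \<and> norm (y - x - \<phi> *\<^sub>R \<omega>) \<le> e * \<phi>"
      if x: "x \<in> cball a (e / 2 * \<rho>)" for x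
    proof (intro exI conjI)
      \<comment> \<open>The witness \<open>x + \<Phi> k x\<close> is the image of \<open>x\<close>
        under the overlap map.\<close>
      show "word_map S (\<alpha> k) (x + \<Phi> k x) = word_map S (\<beta> k) x"
        using bij_word_map[OF w(1)] by (simp add: \<Phi> bij_is_surj surj_f_inv_f)
      have "norm (\<Phi> k x - \<Phi> k a) \<le> \<phi> / \<rho> * norm (x - a)"
        using near by (simp add: \<phi>_def)
      also have "\<dots> \<le> \<phi> / \<rho> * (e / 2 * \<rho>)"
        using x \<phi> \<rho> by (intro mult_left_mono) (auto simp: dist_norm norm_minus_commute)
      finally have "norm (\<Phi> k x - \<Phi> k a) \<le> \<phi> * (e / 2)" using \<rho> by simp
      with 1 have "norm (\<Phi> k x - \<phi> *\<^sub>R \<omega>) \<le> \<phi> * (e / 2) + \<phi> * (e / 2)"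
        by (rule norm_diff_triangle_le[rotated])
      then show "norm (x + \<Phi> k x - x - \<phi> *\<^sub>R \<omega>) \<le> e * \<phi>"
        by (simp add: mult.commute)
    qed
    then show "\<exists>\<alpha> \<beta> \<phi>. set \<alpha> \<subseteq> {1..m} \<and> set \<beta> \<subseteq> {1..m} \<and> 0 < \<phi> \<and> \<phi> < \<theta> \<and>
       (\<forall>x\<in>cball a (e / 2 * \<rho>). \<exists>y. word_map S \<alpha> y = word_map S \<beta> x \<and> norm (y - x - \<phi> *\<^sub>R \<omega>) \<le> e * \<phi>)"
      using w[of k] k(1)[folded \<phi>_def] \<phi> by blast
  qed
qed

section \<open>Zooming into points of the attractor\<close>

lemma word_ratio_le_1: "set w \<subseteq> {1..m} \<Longrightarrow> word_ratio c w \<le> 1"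
proof (induction w)
  case (Cons i w)
  then show ?case
    using c_less[of i] c_pos[of i] word_ratio_pos[of w] by (auto intro!: mult_le_one)
qed simp

lemma attractor_cover: "a \<in> F \<Longrightarrow> \<exists>i\<in>{1..m}. \<exists>a'\<in>F. a = S i a'"
  using attr unfolding is_attractor_def by blast

text \<open>Follow an address of \<open>a\<close> until the ratio first drops below \<theta>: before
  the last letter it was at least \<theta>, and that letter costs at most a factor
  \<open>cm\<close>. The induction bounds the number of letters by some \<open>N\<close> with
  \<open>C ^ N < \<theta>\<close>.\<close>

lemma attractor_word:
  assumes cm: "0 < cm" "\<And>i. i \<in> {1..m} \<Longrightarrow> cm \<le> c i"
  assumes "a \<in> F" "0 < \<theta>" "\<theta> \<le> 1"
  shows "\<exists>w a'. set w \<subseteq> {1..m} \<and> a' \<in> F \<and> a = word_map S w a' \<and>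
    cm * \<theta> \<le> word_ratio c w \<and> word_ratio c w \<le> \<theta>"
proof -
  define C where "C = Max (c ` {1..m})"
  have C: "c i \<le> C" if "i \<in> {1..m}" for i
    unfolding C_def using that by simp
  have "C \<in> c ` {1..m}"
    unfolding C_def using m_pos by (intro Max_in) auto
  then have "0 < C" "C < 1" using c_pos c_less by auto
  then obtain N where "C ^ N < \<theta>" using real_arch_pow_inv[OF assms(4)] by blast
  then show ?thesis using assms(3-)
  proof (induction N arbitrary: a \<theta>)
    \<comment> \<open>Contradictory, as \<open>C ^ 0 = 1\<close> is not below \<theta>.\<close>
    case 0
    then show ?case by simp
  next
    case (Suc N)
    obtain i a' where i: "i \<in> {1..m}" "a' \<in> F" "a = S i a'"
      using attractor_cover[OF Suc.prems(2)] by blast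
    have ci: "0 < c i" by (rule c_pos[OF i(1)])
    show ?case
    proof (cases "\<theta> \<le> c i")
      case False
      have "cm * \<theta> \<le> cm * 1" using Suc.prems(4) cm(1) by (intro mult_left_mono) auto
      then have "cm * \<theta> \<le> c i" using cm(2)[OF i(1)] by simp
      with False i show ?thesis
        by (intro exI[of _ "[i]"] exI[of _ a']) auto
    next
      \<comment> \<open>The first letter is still too coarse, so the search continues from
        \<open>a'\<close> at the scale \<open>\<theta> / c i\<close>.\<close>
      case True
      have "C ^ N * c i \<le> C ^ N * C"
        using C[OF i(1)] \<open>0 < C\<close> by (intro mult_left_mono) auto
      then have "C ^ N < \<theta> / c i"
        using Suc.prems(1) ci by (simp add: field_simps)
      moreover have "0 < \<theta> / c i" "\<theta> / c i \<le> 1" using True ci Suc.prems(3) by auto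
      ultimately obtain w a'' where w: "set w \<subseteq> {1..m}" "a'' \<in> F" "a' = word_map S w a''"
        "cm * (\<theta> / c i) \<le> word_ratio c w" "word_ratio c w \<le> \<theta> / c i"
        using Suc.IH[OF _ i(2)] by blast
      have "cm * \<theta> \<le> c i * word_ratio c w" "c i * word_ratio c w \<le> \<theta>"
        using w(4,5) ci by (simp_all add: field_simps)
      with w(1-3) i show ?thesis
        by (intro exI[of _ "i # w"] exI[of _ a'']) auto
    qed
  qed
qed

text \<open>Conjugating a near-translation by the word \<open>\<eta> @ p @ \<sigma>\<close> rescales it: \<open>\<eta>\<close> zooms into the
  base point far enough to make the step length comparable to \<open>e\<close>, and \<open>p\<close> undoes the rotation.
  That \<open>t0\<close> does not depend on \<open>\<sigma>\<close> is what allows the steps to add up to length one.\<close>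

lemma overlap_step:
  assumes od: "overlapping_direction m S F \<omega>" and e: "0 < e"
  obtains t0 where "0 < t0"
    "\<And>\<sigma>. set \<sigma> \<subseteq> {1..m} \<Longrightarrow> \<exists>\<alpha> \<beta> t. set \<alpha> \<subseteq> {1..m} \<and> set \<beta> \<subseteq> {1..m} \<and> t0 \<le> t \<and> t \<le> e \<and>
       (\<forall>x\<in>cball 0 R. \<exists>y. word_map S (\<alpha> @ \<sigma>) y = word_map S (\<beta> @ \<sigma>) x \<and>
          norm (y - x - t *\<^sub>R \<omega>) \<le> e * t)"
proof -
  have e2: "0 < e / 2" using e by simp
  have \<omega>: "norm \<omega> = 1"
    using od by (auto simp: overlapping_direction_def)
  obtain a \<delta> where a: "a \<in> F" and \<delta>: "0 < \<delta>" and
    near: "\<And>\<theta>. 0 < \<theta> \<Longrightarrow> \<exists>\<alpha> \<beta> \<phi>. set \<alpha> \<subseteq> {1..m} \<and> set \<beta> \<subseteq> {1..m} \<and> 0 < \<phi> \<and> \<phi> < \<theta> \<and>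
       (\<forall>x\<in>cball a \<delta>. \<exists>y. word_map S \<alpha> y = word_map S \<beta> x \<and> norm (y - x - \<phi> *\<^sub>R \<omega>) \<le> e / 2 * \<phi>)"
    by (rule overlap_near_translation[OF od e2]) blast
  obtain P where P: "finite P" "P \<noteq> {}" "\<And>p. p \<in> P \<Longrightarrow> set p \<subseteq> {1..m}" and
    ret: "\<And>w. set w \<subseteq> {1..m} \<Longrightarrow>
       \<exists>p\<in>P. \<forall>z. norm (word_lin L p (word_lin L w z) - z) \<le> e / 2 * norm z"
    by (rule finite_return_words[OF e2]) blast
  \<comment> \<open>Finiteness of \<open>P\<close> bounds the cost of correcting the rotation
    uniformly over all \<sigma>.\<close>
  define q where "q = Min (word_ratio c ` P)"
  have q_le: "q \<le> word_ratio c p" if "p \<in> P" for p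
    unfolding q_def using P(1) that by simp
  have "q \<in> word_ratio c ` P"
    unfolding q_def using P by (intro Min_in) auto
  then have q: "0 < q" using P(3) word_ratio_pos by auto
  define cm where "cm = Min (c ` {1..m})"
  have cm_le: "cm \<le> c i" if "i \<in> {1..m}" for i
    unfolding cm_def using that by simp
  have "cm \<in> c ` {1..m}"
    unfolding cm_def using m_pos by (intro Min_in) auto
  then have cm: "0 < cm" using c_pos by auto
  obtain B where B: "0 < B" "\<And>x. x \<in> F \<Longrightarrow> norm x \<le> B"
    using attr compact_imp_bounded[of F] unfolding is_attractor_def bounded_pos by auto
  \<comment> \<open>The contraction contributes \<open>\<bar>R\<bar> + B\<close>, and two points of
    \<open>F\<close> are at most \<open>2 * B\<close> apart.\<close>
  define D where "D = \<bar>R\<bar> + 3 * B"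
  have D: "0 < D" using B(1) by (simp add: D_def)
  have orbit: "dist (word_map S w x) f \<le> D"
    if w: "set w \<subseteq> {1..m}" and x: "x \<in> cball 0 R" and f: "f \<in> F" for w x f
  proof -
    have "dist (word_map S w x) (word_map S w f) \<le> 1 * dist x f"
      using dist_word_map[OF w] word_ratio_le_1[OF w] by (metis mult_right_mono zero_le_dist)
    also have "\<dots> \<le> norm x + norm f" using norm_triangle_ineq4 by (simp add: dist_norm)
    also have "\<dots> \<le> \<bar>R\<bar> + B" using x B(2)[OF f] by simp
    finally have "dist (word_map S w x) (word_map S w f) \<le> \<bar>R\<bar> + B" .
    moreover have "dist (word_map S w f) f \<le> norm (word_map S w f) + norm f"
      using norm_triangle_ineq4 by (simp add: dist_norm)
    ultimately show ?thesis
      using B(2)[OF f] B(2)[OF word_map_attractor[OF w f]]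
        dist_triangle[of "word_map S w x" f "word_map S w f"] by (simp add: D_def)
  qed
  show ?thesis
  proof
    show "0 < e * cm * q" using e cm q by simp
    fix \<sigma> assume \<sigma>: "set \<sigma> \<subseteq> {1..m}"
    \<comment> \<open>The zoom scale will be \<open>\<phi> / C\<close>. The factor
      \<open>word_ratio c \<sigma>\<close> cancels in \<open>t\<close>, which then lies between
      \<open>e * cm * q\<close> and \<open>e\<close> whatever \<sigma> is.\<close>
    define C where "C = e * cm * q * word_ratio c \<sigma>"
    have s: "0 < word_ratio c \<sigma>" by (rule word_ratio_pos[OF \<sigma>])
    then have C: "0 < C" using e cm q by (simp add: C_def)
    \<comment> \<open>The 1 makes \<open>\<phi> / C\<close> an admissible scale for
      \<open>attractor_word\<close>; \<open>\<delta> / D\<close> keeps the zoomed points in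
      \<open>cball a \<delta>\<close>.\<close>
    then have "0 < C * min 1 (\<delta> / D)" using \<delta> D by simp
    from near[OF this] obtain \<alpha> \<beta> \<phi> where \<alpha>\<beta>: "set \<alpha> \<subseteq> {1..m}" "set \<beta> \<subseteq> {1..m}"
      and \<phi>: "0 < \<phi>" "\<phi> < C * min 1 (\<delta> / D)" and
      move: "\<And>x. x \<in> cball a \<delta> \<Longrightarrow>
        \<exists>y. word_map S \<alpha> y = word_map S \<beta> x \<and> norm (y - x - \<phi> *\<^sub>R \<omega>) \<le> e / 2 * \<phi>"
      by blast
    have "\<phi> / C < min 1 (\<delta> / D)"
      unfolding pos_divide_less_eq[OF C] using \<phi>(2) by (subst mult.commute)
    moreover have "0 < \<phi> / C" using C \<phi>(1) by simp
    ultimately have \<theta>: "\<phi> / C \<le> 1" "\<phi> / C \<le> \<delta> / D" "0 < \<phi> / C" by auto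
    obtain \<eta> a' where \<eta>: "set \<eta> \<subseteq> {1..m}" "a' \<in> F" "a = word_map S \<eta> a'"
      "cm * (\<phi> / C) \<le> word_ratio c \<eta>" "word_ratio c \<eta> \<le> \<phi> / C"
      using attractor_word[OF cm cm_le a \<theta>(3,1)] by blast
    \<comment> \<open>The word to be undone is \<open>\<sigma> @ \<eta>\<close>: the rotation of
      \<open>\<eta> @ p @ \<sigma>\<close> is conjugate by that of \<eta> to the rotation of
      \<open>p @ \<sigma> @ \<eta>\<close>.\<close>
    obtain p where p: "p \<in> P" and
      rot: "\<And>z. norm (word_lin L p (word_lin L (\<sigma> @ \<eta>) z) - z) \<le> e / 2 * norm z"
      using ret[of "\<sigma> @ \<eta>"] \<sigma> \<eta>(1) by auto
    define \<tau> where "\<tau> = \<eta> @ p @ \<sigma>"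
    have \<tau>: "set \<tau> \<subseteq> {1..m}" and p\<sigma>: "set (p @ \<sigma>) \<subseteq> {1..m}"
      using \<eta>(1) P(3)[OF p] \<sigma> by (auto simp: \<tau>_def)
    have \<tau>_pos: "0 < word_ratio c \<tau>" by (rule word_ratio_pos[OF \<tau>])
    define t where "t = \<phi> / word_ratio c \<tau>"
    have t_pos: "0 < t" using \<phi> \<tau>_pos by (simp add: t_def)
    have \<tau>_eq: "word_ratio c \<tau> = word_ratio c \<eta> * (word_ratio c p * word_ratio c \<sigma>)"
      by (simp add: \<tau>_def word_ratio_append)
    have "(cm * (\<phi> / C)) * (q * word_ratio c \<sigma>) \<le> word_ratio c \<tau>"
      unfolding \<tau>_eq using \<eta>(4) q_le[OF p] q s cm \<theta>(3) word_ratio_pos[OF \<eta>(1)]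
      by (intro mult_mono mult_right_mono) auto
    also have "(cm * (\<phi> / C)) * (q * word_ratio c \<sigma>) = \<phi> / e"
      using cm q s e by (simp add: C_def)
    finally have t_le: "t \<le> e"
      using \<tau>_pos e by (simp add: t_def field_simps)
    have "word_ratio c \<tau> \<le> (\<phi> / C) * (1 * word_ratio c \<sigma>)"
      unfolding \<tau>_eq using \<eta>(5) word_ratio_le_1[OF P(3)[OF p]] word_ratio_pos[OF P(3)[OF p]] s \<theta>(3)
      by (intro mult_mono mult_right_mono) auto
    also have "\<dots> = \<phi> / (e * cm * q)"
      using cm q s e by (simp add: C_def)
    finally have t_ge: "e * cm * q \<le> t"
      using \<tau>_pos e cm q by (simp add: t_def field_simps)
    have rot_\<omega>: "norm (word_lin L \<tau> \<omega> - \<omega>) \<le> e / 2"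
    proof -
      obtain z where z: "\<omega> = word_lin L \<eta> z"
        using surj_word_lin[OF \<eta>(1)] by (metis surjD)
      have "word_lin L \<tau> \<omega> - \<omega> = word_lin L \<eta> (word_lin L p (word_lin L (\<sigma> @ \<eta>) z) - z)"
        by (simp add: z \<tau>_def word_lin_append blinfun.diff_right)
      then show ?thesis
        using rot[of z] \<omega> norm_word_lin[OF \<eta>(1)] by (simp add: z)
    qed
    have "\<exists>y. word_map S ((\<alpha> @ \<eta> @ p) @ \<sigma>) y = word_map S ((\<beta> @ \<eta> @ p) @ \<sigma>) x \<and>
        norm (y - x - t *\<^sub>R \<omega>) \<le> e * t" if x: "x \<in> cball 0 R" for x
    proof -
      \<comment> \<open>Both \<open>u\<close> and \<open>a\<close> are images under
        \<open>word_map S \<eta>\<close>, whose ratio is at most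
        \<open>\<delta> / D\<close>.\<close>
      define u where "u = word_map S \<tau> x"
      have "dist a u = word_ratio c \<eta> * dist (word_map S (p @ \<sigma>) x) a'"
        using dist_word_map[OF \<eta>(1)]
        by (simp add: u_def \<tau>_def \<eta>(3) word_map_append dist_commute)
      also have "\<dots> \<le> \<delta> / D * D"
        using orbit[OF p\<sigma> x \<eta>(2)] order_trans[OF \<eta>(5) \<theta>(2)] \<delta> D by (intro mult_mono) auto
      finally have "u \<in> cball a \<delta>" using D by simp
      then obtain y' where y': "word_map S \<alpha> y' = word_map S \<beta> u" "norm (y' - u - \<phi> *\<^sub>R \<omega>) \<le> e / 2 * \<phi>"
        using move by blast
      obtain y where y: "y' = word_map S \<tau> y"
        using bij_is_surj[OF bij_word_map[OF \<tau>]] by (metis surjD)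
      have \<phi>_eq: "\<phi> = word_ratio c \<tau> * t" using \<tau>_pos by (simp add: t_def)
      have "y' - u - \<phi> *\<^sub>R \<omega> = word_ratio c \<tau> *\<^sub>R (word_lin L \<tau> (y - x) - t *\<^sub>R \<omega>)"
        by (simp add: y u_def word_map_diff[OF \<tau>] \<phi>_eq scaleR_diff_right)
      then have "word_ratio c \<tau> * norm (word_lin L \<tau> (y - x) - t *\<^sub>R \<omega>) \<le> word_ratio c \<tau> * (e / 2 * t)"
        using y'(2) \<tau>_pos by (simp add: \<phi>_eq)
      then have 1: "norm (word_lin L \<tau> (y - x) - t *\<^sub>R \<omega>) \<le> e / 2 * t"
        using \<tau>_pos by (simp only: mult_le_cancel_left_pos)
      have "norm (y - x - t *\<^sub>R \<omega>) = norm (word_lin L \<tau> (y - x - t *\<^sub>R \<omega>))"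
        by (simp add: norm_word_lin[OF \<tau>])
      \<comment> \<open>The error splits into that of the near-translation and that of the imperfect
        rotation, each at most \<open>e / 2 * t\<close>.\<close>
      also have "word_lin L \<tau> (y - x - t *\<^sub>R \<omega>)
          = (word_lin L \<tau> (y - x) - t *\<^sub>R \<omega>) - t *\<^sub>R (word_lin L \<tau> \<omega> - \<omega>)"
        by (simp add: blinfun.diff_right blinfun.scaleR_right scaleR_diff_right)
      also have "norm \<dots> \<le> norm (word_lin L \<tau> (y - x) - t *\<^sub>R \<omega>) + norm (t *\<^sub>R (word_lin L \<tau> \<omega> - \<omega>))"
        by (rule norm_triangle_ineq4)
      also have "norm (t *\<^sub>R (word_lin L \<tau> \<omega> - \<omega>)) \<le> t * (e / 2)"
        using rot_\<omega> t_pos by simp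
      finally have "norm (y - x - t *\<^sub>R \<omega>) \<le> e * t" using 1 by (simp add: algebra_simps)
      moreover have "word_map S ((\<alpha> @ \<eta> @ p) @ \<sigma>) y = word_map S ((\<beta> @ \<eta> @ p) @ \<sigma>) x"
        using y'(1) by (simp add: y u_def \<tau>_def word_map_append)
      ultimately show ?thesis by blast
    qed
    moreover have "set (\<alpha> @ \<eta> @ p) \<subseteq> {1..m}" "set (\<beta> @ \<eta> @ p) \<subseteq> {1..m}"
      using \<alpha>\<beta> \<eta>(1) P(3)[OF p] by auto
    ultimately show "\<exists>\<alpha> \<beta> t. set \<alpha> \<subseteq> {1..m} \<and> set \<beta> \<subseteq> {1..m} \<and> e * cm * q \<le> t \<and> t \<le> e \<and>
       (\<forall>x\<in>cball 0 R. \<exists>y. word_map S (\<alpha> @ \<sigma>) y = word_map S (\<beta> @ \<sigma>) x \<and>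
          norm (y - x - t *\<^sub>R \<omega>) \<le> e * t)"
      using t_ge t_le by blast
  qed
qed

end

section \<open>Filling in the parallelotope\<close>

lemma parallelotope_Suc:
  "parallelotope (Suc s) \<omega> = {v + u *\<^sub>R \<omega> (Suc s) | v u. v \<in> parallelotope s \<omega> \<and> u \<in> {0..1}}"
  (is "?A = ?B")
proof
  show "?A \<subseteq> ?B"
    unfolding parallelotope_def by fastforce
  show "?B \<subseteq> ?A"
  proof
    fix y assume "y \<in> ?B"
    then obtain t u where t: "\<forall>i\<in>{1..s}. 0 \<le> t i \<and> t i \<le> 1" and u: "u \<in> {0..1}"
      and y: "y = (\<Sum>i=1..s. t i *\<^sub>R \<omega> i) + u *\<^sub>R \<omega> (Suc s)"
      unfolding parallelotope_def by blast
    have "(\<Sum>i=1..s. (t(Suc s := u)) i *\<^sub>R \<omega> i) = (\<Sum>i=1..s. t i *\<^sub>R \<omega> i)"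
      by (intro sum.cong) auto
    then have "y = (\<Sum>i=1..Suc s. (t(Suc s := u)) i *\<^sub>R \<omega> i)" using y by simp
    moreover have "\<forall>i\<in>{1..Suc s}. 0 \<le> (t(Suc s := u)) i \<and> (t(Suc s := u)) i \<le> 1"
      using t u by auto
    ultimately show "y \<in> ?A" unfolding parallelotope_def by blast
  qed
qed

lemma bounded_parallelotope: "bounded (parallelotope s \<omega>)"
  unfolding bounded_iff
proof (intro exI ballI)
  fix v assume "v \<in> parallelotope s \<omega>"
  then obtain t where "\<forall>i\<in>{1..s}. 0 \<le> t i \<and> t i \<le> 1" "v = (\<Sum>i=1..s. t i *\<^sub>R \<omega> i)"
    unfolding parallelotope_def by blast
  then show "norm v \<le> (\<Sum>i=1..s. norm (\<omega> i))"
    by (auto intro!: sum_norm_le mult_left_le_one_le)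
qed

section \<open>Approximating translates of the attractor by blow-ups\<close>

context ifs_attractor
begin

text \<open>\<open>F + v\<close> lies in the \<kappa>-neighbourhood of the preimage of
  \<open>F\<close> under \<open>word_map S \<sigma>\<close>. This one-sided closeness suffices,
  since the weak tangent only has to contain the translates.\<close>

definition approx :: "nat list \<Rightarrow> real^'n \<Rightarrow> real \<Rightarrow> bool" where
  "approx \<sigma> v \<kappa> \<longleftrightarrow> (\<forall>x\<in>F. \<exists>z. word_map S \<sigma> z \<in> F \<and> norm (z - (x + v)) \<le> \<kappa>)"

lemma approx_mono:
  assumes "approx \<sigma> v \<kappa>" "norm (v - v') + \<kappa> \<le> \<kappa>'"
  shows "approx \<sigma> v' \<kappa>'"
  unfolding approx_def
proof
  fix x assume "x \<in> F"
  then obtain z where z: "word_map S \<sigma> z \<in> F" "norm (z - (x + v)) \<le> \<kappa>"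
    using assms(1) by (auto simp: approx_def)
  have "norm (z - (x + v')) \<le> norm (z - (x + v)) + norm (v - v')"
    using norm_triangle_ineq[of "z - (x + v)" "v - v'"] by (simp add: algebra_simps)
  then show "\<exists>z. word_map S \<sigma> z \<in> F \<and> norm (z - (x + v')) \<le> \<kappa>'"
    using z assms(2) by (intro exI[of _ z]) auto
qed

text \<open>Since \<open>word_map S \<alpha>\<close> maps \<open>F\<close> into itself, prepending
  \<alpha> only enlarges the blow-up; hence translates already reached are never lost.\<close>

lemma approx_append:
  assumes "set \<alpha> \<subseteq> {1..m}" "approx \<sigma> v \<kappa>"
  shows "approx (\<alpha> @ \<sigma>) v \<kappa>"
  using assms word_map_attractor[OF assms(1)] unfolding approx_def word_map_append by fastforce

text \<open>A point \<open>z\<close> of the old blow-up is sent into \<open>F\<close> by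
  \<open>\<beta> @ \<sigma>\<close> too. Its partner \<open>y\<close>, close to
  \<open>z + d\<close>, has the same image under \<open>\<alpha> @ \<sigma>\<close>, so it lies in
  the new blow-up. The bound by \<open>R\<close> keeps \<open>z\<close> where \<open>move\<close>
  applies.\<close>

lemma approx_shift:
  assumes \<beta>: "set \<beta> \<subseteq> {1..m}" and v: "approx \<sigma> v \<kappa>"
    and move: "\<And>x. x \<in> cball 0 R \<Longrightarrow> \<exists>y. word_map S (\<alpha> @ \<sigma>) y = word_map S (\<beta> @ \<sigma>) x \<and>
          norm (y - x - d) \<le> \<mu>"
    and B: "\<And>x. x \<in> F \<Longrightarrow> norm x \<le> B" and R: "norm v + \<kappa> + B \<le> R"
  shows "approx (\<alpha> @ \<sigma>) (v + d) (\<kappa> + \<mu>)"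
  unfolding approx_def
proof
  fix x assume x: "x \<in> F"
  then obtain z where z: "word_map S \<sigma> z \<in> F" "norm (z - (x + v)) \<le> \<kappa>"
    using v by (auto simp: approx_def)
  have "norm z \<le> norm (z - (x + v)) + (norm x + norm v)"
    using norm_triangle_sub[of z "x + v"] norm_triangle_ineq[of x v] by linarith
  then have "z \<in> cball 0 R" using z(2) B[OF x] R by simp
  then obtain y where y: "word_map S (\<alpha> @ \<sigma>) y = word_map S (\<beta> @ \<sigma>) z" "norm (y - z - d) \<le> \<mu>"
    using move by blast
  have "word_map S (\<alpha> @ \<sigma>) y \<in> F"
    using y(1) word_map_attractor[OF \<beta> z(1)] by (simp add: word_map_append)
  moreover have "norm (y - (x + (v + d))) \<le> \<kappa> + \<mu>"
    using norm_triangle_ineq[of "z - (x + v)" "y - z - d"] z(2) y(2) by (simp add: algebra_simps)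
  ultimately show "\<exists>z. word_map S (\<alpha> @ \<sigma>) z \<in> F \<and> norm (z - (x + (v + d))) \<le> \<kappa> + \<mu>" by blast
qed

text \<open>Steps of length between \<open>t0\<close> and \<open>e\<close> reach 1 after finitely
  many rounds and leave an \<open>e\<close>-dense trail of shifts. Each error is proportional to its
  step length, so the total stays bounded however many steps are made.\<close>

lemma approx_segment:
  assumes od: "overlapping_direction m S F \<omega>"
    and V: "bounded V" "\<And>\<kappa>. 0 < \<kappa> \<Longrightarrow> \<exists>\<sigma>. set \<sigma> \<subseteq> {1..m} \<and> (\<forall>v\<in>V. approx \<sigma> v \<kappa>)"
    and \<kappa>: "0 < \<kappa>"
  shows "\<exists>\<sigma>. set \<sigma> \<subseteq> {1..m} \<and> (\<forall>v\<in>V. \<forall>u\<in>{0..1}. approx \<sigma> (v + u *\<^sub>R \<omega>) \<kappa>)"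
proof -
  have \<omega>: "norm \<omega> = 1"
    using od by (auto simp: overlapping_direction_def)
  \<comment> \<open>The final error is at most \<open>4 * e\<close>: \<open>e\<close> from the
    trail, \<open>e\<close> from \<open>\<sigma>0\<close> and \<open>2 * e\<close> from the steps.
    With \<open>e \<le> 1\<close>, a step starting below 1 ends at most at 2.\<close>
  define e where "e = min 1 (\<kappa> / 4)"
  have e: "0 < e" "e \<le> 1" "4 * e \<le> \<kappa>" using \<kappa> by (auto simp: e_def)
  obtain B where B: "0 < B" "\<And>x. x \<in> F \<Longrightarrow> norm x \<le> B"
    using attr compact_imp_bounded[of F] unfolding is_attractor_def bounded_pos by auto
  obtain M where M: "\<And>v. v \<in> V \<Longrightarrow> norm v \<le> M"
    using V(1) unfolding bounded_iff by auto
  obtain \<sigma>0 where \<sigma>0: "set \<sigma>0 \<subseteq> {1..m}" "\<And>v. v \<in> V \<Longrightarrow> approx \<sigma>0 v e"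
    using V(2)[OF e(1)] by auto
  define R where "R = M + 2 + (e + e * 2) + B"
  obtain t0 where t0: "0 < t0" and
    step: "\<And>\<sigma>. set \<sigma> \<subseteq> {1..m} \<Longrightarrow> \<exists>\<alpha> \<beta> t. set \<alpha> \<subseteq> {1..m} \<and> set \<beta> \<subseteq> {1..m} \<and> t0 \<le> t \<and> t \<le> e \<and>
       (\<forall>x\<in>cball 0 R. \<exists>y. word_map S (\<alpha> @ \<sigma>) y = word_map S (\<beta> @ \<sigma>) x \<and>
          norm (y - x - t *\<^sub>R \<omega>) \<le> e * t)"
    by (rule overlap_step[OF od e(1)]) blast
  \<comment> \<open>\<open>T\<close> is the total shift so far. The shift \<open>d\<close> close to
    \<open>u\<close> is the same for all of \<open>V\<close>.\<close>
  define good where "good \<sigma> T \<longleftrightarrow> set \<sigma> \<subseteq> {1..m} \<and> 0 \<le> T \<and> T \<le> 2 \<and>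
      (\<forall>v\<in>V. approx \<sigma> (v + T *\<^sub>R \<omega>) (e + e * T)) \<and>
      (\<forall>u\<in>{0..T}. \<exists>d. \<bar>d - u\<bar> \<le> e \<and> (\<forall>v\<in>V. approx \<sigma> (v + d *\<^sub>R \<omega>) (e + e * T)))" for \<sigma> T
  have "\<exists>\<sigma> T. good \<sigma> T \<and> min 1 (real N * t0) \<le> T" for N
  proof (induction N)
    case 0
    have "good \<sigma>0 0"
      unfolding good_def using \<sigma>0 e by (auto intro!: exI[of _ 0])
    then show ?case by (intro exI[of _ \<sigma>0] exI[of _ 0]) simp
  next
    case (Suc N)
    then obtain \<sigma> T where good: "good \<sigma> T" and T: "min 1 (real N * t0) \<le> T" by auto
    show ?case
    proof (cases "1 \<le> T")
      case True
      with good show ?thesis by (intro exI[of _ \<sigma>] exI[of _ T]) auto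
    next
      case False
      have \<sigma>: "set \<sigma> \<subseteq> {1..m}" and T_end: "\<And>v. v \<in> V \<Longrightarrow> approx \<sigma> (v + T *\<^sub>R \<omega>) (e + e * T)"
        and T0: "0 \<le> T"
        using good by (auto simp: good_def)
      obtain \<alpha> \<beta> t where \<alpha>\<beta>: "set \<alpha> \<subseteq> {1..m}" "set \<beta> \<subseteq> {1..m}" and t: "t0 \<le> t" "t \<le> e" and
        move: "\<And>x. x \<in> cball 0 R \<Longrightarrow> \<exists>y. word_map S (\<alpha> @ \<sigma>) y = word_map S (\<beta> @ \<sigma>) x \<and>
          norm (y - x - t *\<^sub>R \<omega>) \<le> e * t"
        using step[OF \<sigma>] by blast
      have new: "approx (\<alpha> @ \<sigma>) (v + (T + t) *\<^sub>R \<omega>) (e + e * (T + t))" if v: "v \<in> V" for v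
      proof -
        have "norm (v + T *\<^sub>R \<omega>) \<le> M + T"
          using norm_triangle_ineq[of v "T *\<^sub>R \<omega>"] M[OF v] \<omega> T0 by simp
        moreover have "e * T \<le> e * 2" using False e by (intro mult_left_mono) auto
        ultimately have "norm (v + T *\<^sub>R \<omega>) + (e + e * T) + B \<le> R"
          using False by (simp add: R_def)
        from approx_shift[OF \<alpha>\<beta>(2) T_end[OF v] move B(2) this] show ?thesis
          by (simp add: algebra_simps)
      qed
      have old: "approx (\<alpha> @ \<sigma>) v' (e + e * (T + t))" if "approx \<sigma> v' (e + e * T)" for v'
        by (rule approx_mono[OF approx_append[OF \<alpha>\<beta>(1) that]])
          (use t t0 e in \<open>simp add: algebra_simps\<close>)
      have "\<exists>d. \<bar>d - u\<bar> \<le> e \<and> (\<forall>v\<in>V. approx (\<alpha> @ \<sigma>) (v + d *\<^sub>R \<omega>) (e + e * (T + t)))"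
        if u: "u \<in> {0..T + t}" for u
      proof (cases "u \<le> T")
        case True
        then have "u \<in> {0..T}" using u by simp
        then obtain d where "\<bar>d - u\<bar> \<le> e" "\<forall>v\<in>V. approx \<sigma> (v + d *\<^sub>R \<omega>) (e + e * T)"
          using good unfolding good_def by blast
        then show ?thesis using old by blast
      next
        case False
        \<comment> \<open>Between \<open>T\<close> and \<open>T + t\<close> the new endpoint is
          within \<open>t \<le> e\<close> of \<open>u\<close>.\<close>
        then show ?thesis using u t new by (intro exI[of _ "T + t"]) auto
      qed
      then have "good (\<alpha> @ \<sigma>) (T + t)"
        unfolding good_def using \<sigma> \<alpha>\<beta>(1) new False t t0 e T0 by auto
      moreover have "min 1 (real (Suc N) * t0) \<le> T + t"
        using T t False by (simp add: algebra_simps)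
      ultimately show ?thesis by blast
    qed
  qed
  moreover obtain N :: nat where "1 < real N * t0" using reals_Archimedean3[OF t0] by blast
  ultimately obtain \<sigma> T where good: "good \<sigma> T" and T: "1 \<le> T" by (metis less_imp_le min.absorb1)
  have "approx \<sigma> (v + u *\<^sub>R \<omega>) \<kappa>" if v: "v \<in> V" and u: "u \<in> {0..1}" for v u
  proof -
    have "u \<in> {0..T}" using u T by simp
    then obtain d where d: "\<bar>d - u\<bar> \<le> e" "approx \<sigma> (v + d *\<^sub>R \<omega>) (e + e * T)"
      using good v unfolding good_def by blast
    have "norm (v + d *\<^sub>R \<omega> - (v + u *\<^sub>R \<omega>)) = \<bar>d - u\<bar>"
      using \<omega> by (simp add: scaleR_diff_left[symmetric])
    moreover have "e * T \<le> e * 2" using good e by (intro mult_left_mono) (auto simp: good_def)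
    ultimately show ?thesis using d e by (intro approx_mono[OF d(2)]) linarith
  qed
  then show ?thesis using good unfolding good_def by blast
qed

text \<open>The induction adds one edge at a time. It runs for all \<kappa> at once, because
  \<open>approx_segment\<close> needs the previous parallelotope at a finer precision.\<close>

lemma approx_parallelotope:
  assumes od: "\<forall>i\<in>{1..s}. overlapping_direction m S F (\<omega> i)" and "0 < \<kappa>"
  shows "\<exists>\<sigma>. set \<sigma> \<subseteq> {1..m} \<and> (\<forall>v\<in>parallelotope s \<omega>. approx \<sigma> v \<kappa>)"
  using assms
proof (induction s arbitrary: \<kappa>)
  case 0
  have "approx [] v \<kappa>" if "v \<in> parallelotope 0 \<omega>" for v
    using that 0 by (auto simp: parallelotope_def approx_def intro!: exI)
  then show ?case by (intro exI[of _ "[]"]) auto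
next
  case (Suc s)
  have IH: "\<exists>\<sigma>. set \<sigma> \<subseteq> {1..m} \<and> (\<forall>v\<in>parallelotope s \<omega>. approx \<sigma> v \<kappa>)" if "0 < \<kappa>" for \<kappa>
    using Suc.IH[OF _ that] Suc.prems(1) by simp
  have "overlapping_direction m S F (\<omega> (Suc s))" using Suc.prems(1) by simp
  from approx_segment[OF this bounded_parallelotope IH Suc.prems(2)] show ?case
    unfolding parallelotope_Suc by auto
qed

section \<open>Passage to a weak tangent\<close>

lemma weak_tangent_of_approx:
  assumes V: "bounded V" "V \<noteq> {}"
    and approx: "\<And>\<kappa>. 0 < \<kappa> \<Longrightarrow> \<exists>\<sigma>. set \<sigma> \<subseteq> {1..m} \<and> (\<forall>v\<in>V. approx \<sigma> v \<kappa>)"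
  shows "\<exists>G. weak_tangent F G \<and> {v + x | v x. v \<in> V \<and> x \<in> F} \<subseteq> G"
proof -
  have F: "F \<noteq> {}" "compact F" using attr by (auto simp: is_attractor_def)
  obtain B where B: "\<And>x. x \<in> F \<Longrightarrow> norm x \<le> B"
    using compact_imp_bounded[OF F(2)] unfolding bounded_iff by auto
  obtain M where M: "\<And>v. v \<in> V \<Longrightarrow> norm v \<le> M"
    using V(1) unfolding bounded_iff by auto
  have M0: "0 \<le> M" using V(2) M norm_ge_zero order_trans by blast
  \<comment> \<open>The extra 1 absorbs the approximation error \<open>1 / real (Suc n)\<close>, so
    the approximating points survive the intersection with \<open>X\<close>.\<close>
  define X where "X = cball (0::real^'n) (B + M + 1)"
  have "\<forall>n. \<exists>\<sigma>. set \<sigma> \<subseteq> {1..m} \<and> (\<forall>v\<in>V. approx \<sigma> v (1 / real (Suc n)))"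
    using approx by simp
  then obtain \<sigma> where \<sigma>: "\<And>n. set (\<sigma> n) \<subseteq> {1..m}" and
    \<sigma>_approx: "\<And>n v. v \<in> V \<Longrightarrow> approx (\<sigma> n) v (1 / real (Suc n))" by metis
  define T where "T n = inv (word_map S (\<sigma> n))" for n
  have sim: "similitude (T n)" for n
    unfolding T_def by (intro similitude_inv similitude_word[OF \<sigma>])
  define K where "K n = T n ` F \<inter> X" for n
  have close: "\<exists>z\<in>K n. norm (z - (v + x)) \<le> 1 / real (Suc n)" if v: "v \<in> V" and x: "x \<in> F" for v x n
  proof -
    obtain z where z: "word_map S (\<sigma> n) z \<in> F" "norm (z - (x + v)) \<le> 1 / real (Suc n)"
      using \<sigma>_approx[OF v] x unfolding approx_def by blast
    have "z = T n (word_map S (\<sigma> n) z)"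
      unfolding T_def using bij_word_map[OF \<sigma>] by (simp add: bij_is_inj)
    moreover have "norm z \<le> B + M + 1"
    proof -
      have "norm z \<le> norm (z - (x + v)) + (norm x + norm v)"
        using norm_triangle_sub[of z "x + v"] norm_triangle_ineq[of x v] by linarith
      moreover have "1 / real (Suc n) \<le> 1" by simp
      ultimately show ?thesis using z(2) B[OF x] M[OF v] by linarith
    qed
    ultimately have "z \<in> K n" using z(1) by (auto simp: K_def X_def)
    then show ?thesis using z(2) by (auto simp: add.commute)
  qed
  have X: "compact X" by (simp add: X_def)
  have K: "K n \<subseteq> X" "K n \<noteq> {}" for n
  proof -
    show "K n \<subseteq> X" by (simp add: K_def)
    obtain v x where "v \<in> V" "x \<in> F" using V(2) F(1) by blast
    then show "K n \<noteq> {}" using close by blast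
  qed
  obtain r G where r: "strict_mono (r :: nat \<Rightarrow> nat)" and G: "compact G" "G \<noteq> {}" "G \<subseteq> X"
    and lim: "(\<lambda>n. hausdorff_dist (K (r n)) G) \<longlonglongrightarrow> 0"
    and mem: "\<And>x. x \<in> X \<Longrightarrow> (\<lambda>n. infdist x (K n)) \<longlonglongrightarrow> 0 \<Longrightarrow> x \<in> G"
    by (rule hausdorff_convergent_subseq[of X K, OF X K]) blast
  have "weak_tangent F G"
    unfolding weak_tangent_def
  proof (intro conjI exI allI)
    show "F \<subseteq> X" using B M0 by (force simp: X_def)
    show "(\<lambda>k. hausdorff_dist (T (r k) ` F \<inter> X) G) \<longlonglongrightarrow> 0"
      using lim by (simp add: K_def)
    show "T (r k) ` F \<inter> X \<noteq> {}" for k using K(2)[of "r k"] by (simp add: K_def)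
  qed (use F G X sim in auto)
  \<comment> \<open>Membership follows from distances to the \<open>K n\<close> tending to 0 along
    the whole sequence, hence along the chosen subsequence.\<close>
  moreover have "v + x \<in> G" if v: "v \<in> V" and x: "x \<in> F" for v x
  proof (rule mem)
    show "v + x \<in> X"
      using norm_triangle_ineq[of v x] B[OF x] M[OF v] by (simp add: X_def)
    have "infdist (v + x) (K n) \<le> 1 / real (Suc n)" for n
      using close[OF v x, of n] infdist_le2
      by (metis dist_commute dist_norm)
    then show "(\<lambda>n. infdist (v + x) (K n)) \<longlonglongrightarrow> 0"
      by (intro tendsto_sandwich[OF _ _ tendsto_const LIMSEQ_Suc[OF lim_inverse_n']])
        (auto simp: infdist_nonneg)
  qed
  ultimately show ?thesis by blast
qed

end

theorem theorem1p9:
  fixes S :: "nat \<Rightarrow> real^'n \<Rightarrow> real^'n" and m s :: nat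
    and F :: "(real^'n) set" and \<omega> :: "nat \<Rightarrow> real^'n"
  assumes "ifs m S"
    and "is_attractor m S F"
    and "\<not> in_hyperplane F"
    and "\<not> weak_separation m S"
    and "\<forall>i\<in>{1..s}. overlapping_direction m S F (\<omega> i)"
    and "inj_on \<omega> {1..s}" and "independent (\<omega> ` {1..s})"
  shows "s \<le> dim (overlap_space m S F) \<and>
    (\<exists>G. weak_tangent F G \<and> {w + x | w x. w \<in> parallelotope s \<omega> \<and> x \<in> F} \<subseteq> G)"
proof
  have "\<omega> ` {1..s} \<subseteq> overlap_space m S F"
    using assms(5) unfolding overlap_space_def by (auto intro: span_base)
  then have "card (\<omega> ` {1..s}) \<le> dim (overlap_space m S F)"
    using assms(7) independent_card_le_dim by blast
  then show "s \<le> dim (overlap_space m S F)"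
    using card_image[OF assms(6)] by simp
next
  have "\<exists>c L b. 0 < c \<and> c < 1 \<and> (\<forall>x. norm (blinfun_apply L x) = norm x) \<and>
      (\<forall>x. S i x = c *\<^sub>R blinfun_apply L x + b)" if i: "i \<in> {1..m}" for i
  proof -
    obtain c where c: "c < 1" "similitude_ratio c (S i)"
      using assms(1) i unfolding ifs_def by blast
    obtain L b where "\<And>x. norm (blinfun_apply L x) = norm x" "\<And>x. S i x = c *\<^sub>R blinfun_apply L x + b"
      by (rule similitude_ratio_blinfun[OF c(2)]) blast
    moreover have "0 < c" using c(2) by (simp add: similitude_ratio_def)
    ultimately show ?thesis using c(1) by blast
  qed
  then obtain c L b where data: "\<And>i. i \<in> {1..m} \<Longrightarrow> 0 < c i \<and> c i < 1 \<and>
      (\<forall>x. norm (blinfun_apply (L i) x) = norm x) \<and> (\<forall>x. S i x = c i *\<^sub>R blinfun_apply (L i) x + b i)"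
    by metis
  interpret ifs_attractor m S F c L b
    using data assms(1,2) by unfold_locales auto
  show "\<exists>G. weak_tangent F G \<and> {w + x | w x. w \<in> parallelotope s \<omega> \<and> x \<in> F} \<subseteq> G"
  proof (rule weak_tangent_of_approx[OF bounded_parallelotope])
    show "parallelotope s \<omega> \<noteq> {}" by (force simp: parallelotope_def)
  qed (rule approx_parallelotope[OF assms(5)])
qed

end
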